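(* Let $p>0$, $q_1,\ldots,q_n$ be integers such that $p$ is relatively prime to each $q_i$. Let $r_1,\ldots,r_n$ be integers obtained from $q_1,\ldots,q_n$ as follows: let $\mathbf{q}=(-q_1,\ldots,-q_n)^t$, choose any $B\in SL(n,\mathbb{Z})$ and put $\mathbf{a}=B\mathbf{q}$; choose any $\mathbf{a}'\in\mathbb{Z}^n$ with $\mathbf{a}'\equiv\mathbf{a}\pmod p$; put $\mathbf{q}'=-B^{-1}\mathbf{a}'$; and choose any $(r_1,\ldots,r_n)^t\in\mathbb{Z}^n$ with $(r_1,\ldots,r_n)^t\equiv\mathbf{q}'\pmod p$. Then the lens spaces $L(p;q_1,\ldots,q_n)$ and $L(p;r_1,\ldots,r_n)$ are diffeomorphic.
   Context: For integers $p>0,q_1,\dots,q_n$ with $p$ relatively prime to each $q_i$, $L(p;q_1,\dots,q_n)$ is the orbit space $S^{2n+1}/\mathbb{Z}_p$, where $S^{2n+1}\subset\mathbb{C}^{n+1}$ is the unit sphere and $k\in\mathbb{Z}_p$ acts by $(z_1,\dots,z_{n+1})\mapsto(e^{2\pi\sqrt{-1}kq_1/p}z_1,\dots,e^{2\pi\sqrt{-1}kq_n/p}z_n,e^{2\pi\sqrt{-1}k/p}z_{n+1})$. *)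

theory Defs
  imports
    "HOL-Analysis.Analysis"
    "HOL-Algebra.Group_Action"
    "HOL-Algebra.Elementary_Groups"
    "HOL-Number_Theory.Cong"
begin

section \<open>Smooth functions between Euclidean spaces\<close>

text \<open>\<open>Ck_on k S f\<close> is meant for open \<open>S\<close>: all iterated directional derivatives of \<open>f\<close> of order
  below \<open>k\<close> are (Frechet) differentiable on \<open>S\<close>, and those of order \<open>k\<close> are continuous.\<close>

primrec Ck_on ::
    "nat \<Rightarrow> 'a::euclidean_space set \<Rightarrow> ('a \<Rightarrow> 'b::euclidean_space) \<Rightarrow> bool" where
  "Ck_on 0 S f \<longleftrightarrow> continuous_on S f"
| "Ck_on (Suc k) S f \<longleftrightarrow>
     (\<forall>x\<in>S. f differentiable (at x)) \<and>
     (\<forall>v. Ck_on k S (\<lambda>x. frechet_derivative f (at x) v))"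

definition smooth_on :: "'a::euclidean_space set \<Rightarrow> ('a \<Rightarrow> 'b::euclidean_space) \<Rightarrow> bool" where
  "smooth_on S f \<longleftrightarrow> (\<forall>k. Ck_on k S f)"

text \<open>Smoothness on an arbitrary subset of a Euclidean space: \<open>f\<close> extends locally to a smooth
  function on an open subset of the ambient space.\<close>

definition extends_smoothly_on ::
    "'a::euclidean_space set \<Rightarrow> ('a \<Rightarrow> 'b::euclidean_space) \<Rightarrow> bool" where
  "extends_smoothly_on S f \<longleftrightarrow>
     (\<forall>x\<in>S. \<exists>W F. open W \<and> x \<in> W \<and> smooth_on W F \<and> (\<forall>y\<in>S \<inter> W. F y = f y))"


section \<open>Smooth manifolds and diffeomorphisms\<close>

text \<open>A chart \<open>(U, \<phi>)\<close> is given by a total function \<open>\<phi>\<close>, only the values of which on \<open>U\<close> matter.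
  A manifold is a topology together with an atlas (not necessarily maximal), modelled on the
  Euclidean space \<open>'e\<close>.\<close>

type_synonym ('a, 'e) chart = "'a set \<times> ('a \<Rightarrow> 'e)"
type_synonym ('a, 'e) manifold = "'a topology \<times> ('a, 'e) chart set"

definition is_chart :: "'a topology \<Rightarrow> ('a, 'e::euclidean_space) chart \<Rightarrow> bool" where
  "is_chart X = (\<lambda>(U, \<phi>).
     openin X U \<and> open (\<phi> ` U) \<and>
     homeomorphic_map (subtopology X U) (top_of_set (\<phi> ` U)) \<phi>)"

definition smooth_manifold :: "('a, 'e::euclidean_space) manifold \<Rightarrow> bool" where
  "smooth_manifold = (\<lambda>(X, A).
     Hausdorff_space X \<and> second_countable X \<and>
     (\<forall>c\<in>A. is_chart X c) \<and>
     (\<Union>(U, \<phi>)\<in>A. U) = topspace X \<and>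
     (\<forall>(U, \<phi>)\<in>A. \<forall>(V, \<psi>)\<in>A. smooth_on (\<phi> ` (U \<inter> V)) (\<psi> \<circ> inv_into U \<phi>)))"

definition smooth_map ::
    "('a, 'd::euclidean_space) manifold \<Rightarrow> ('b, 'e::euclidean_space) manifold \<Rightarrow> ('a \<Rightarrow> 'b) \<Rightarrow> bool"
  where
  "smooth_map = (\<lambda>(X, A) (Y, B) f.
     continuous_map X Y f \<and>
     (\<forall>(U, \<phi>)\<in>A. \<forall>(V, \<psi>)\<in>B.
        smooth_on (\<phi> ` {x\<in>U. f x \<in> V}) (\<psi> \<circ> f \<circ> inv_into U \<phi>)))"

definition diffeomorphic ::
    "('a, 'd::euclidean_space) manifold \<Rightarrow> ('b, 'e::euclidean_space) manifold \<Rightarrow> bool" where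
  "diffeomorphic M N \<longleftrightarrow>
     smooth_manifold M \<and> smooth_manifold N \<and>
     (\<exists>f g. smooth_map M N f \<and> smooth_map N M g \<and>
        (\<forall>x\<in>topspace (fst M). g (f x) = x) \<and> (\<forall>y\<in>topspace (fst N). f (g y) = y))"


section \<open>Embedded submanifolds and orbit spaces\<close>

text \<open>The standard smooth structure of a subset \<open>S\<close> of a Euclidean space that is an embedded
  submanifold: all diffeomorphisms (in the sense of extendable smooth maps) from relatively open
  subsets of \<open>S\<close> onto open subsets of \<open>'e\<close>, where \<open>'e\<close> must have the dimension of \<open>S\<close>.\<close>

definition embedded_manifold :: "'a::euclidean_space set \<Rightarrow> ('a, 'e::euclidean_space) manifold" where
  "embedded_manifold S =
     (top_of_set S,
      {(U, \<phi>). openin (top_of_set S) U \<and> inj_on \<phi> U \<and> extends_smoothly_on U \<phi> \<and>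
               open (\<phi> ` U) \<and> smooth_on (\<phi> ` U) (inv_into U \<phi>)})"

definition quotient_topology :: "'a topology \<Rightarrow> ('a \<Rightarrow> 'b) \<Rightarrow> 'b topology" where
  "quotient_topology X f =
     topology (\<lambda>V. V \<subseteq> f ` topspace X \<and> openin X {x \<in> topspace X. f x \<in> V})"

lemma openin_quotient_topology:
  "openin (quotient_topology X f) V \<longleftrightarrow>
     V \<subseteq> f ` topspace X \<and> openin X {x \<in> topspace X. f x \<in> V}"
proof -
  have "istopology (\<lambda>V. V \<subseteq> f ` topspace X \<and> openin X {x \<in> topspace X. f x \<in> V})"
    unfolding istopology_def
  proof (intro conjI allI impI; (elim conjE)?)
    fix S T
    assume "openin X {x \<in> topspace X. f x \<in> S}" "openin X {x \<in> topspace X. f x \<in> T}"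
    moreover have "{x \<in> topspace X. f x \<in> S \<inter> T} =
        {x \<in> topspace X. f x \<in> S} \<inter> {x \<in> topspace X. f x \<in> T}"
      by blast
    ultimately show "openin X {x \<in> topspace X. f x \<in> S \<inter> T}"
      by (simp add: openin_Int)
  next
    fix K
    assume K: "\<forall>S\<in>K. S \<subseteq> f ` topspace X \<and> openin X {x \<in> topspace X. f x \<in> S}"
    have "{x \<in> topspace X. f x \<in> \<Union>K} = (\<Union>S\<in>K. {x \<in> topspace X. f x \<in> S})"
      by blast
    then show "openin X {x \<in> topspace X. f x \<in> \<Union>K}"
      using K by auto
  qed auto
  then show ?thesis
    by (simp add: quotient_topology_def)
qed

lemma quotient_map_quotient_topology: "quotient_map X (quotient_topology X f) f"
proof -
  have "openin X {x \<in> topspace X. f x \<in> f ` topspace X}"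
    by (metis (mono_tags, lifting) Collect_cong Collect_mem_eq imageI openin_topspace)
  then have "openin (quotient_topology X f) (f ` topspace X)"
    by (simp add: openin_quotient_topology)
  then have "topspace (quotient_topology X f) = f ` topspace X"
    by (meson openin_quotient_topology openin_subset openin_topspace subset_antisym)
  then show ?thesis
    by (auto simp: quotient_map_def openin_quotient_topology)
qed

text \<open>The quotient of a manifold by a free, properly discontinuous smooth group action.  The charts
  are \<open>\<phi> \<circ> (\<pi>|U)\<inverse>\<close>, where \<open>\<pi>\<close> is the projection to the orbits and \<open>(U, \<phi>)\<close> is a chart such that
  \<open>\<pi>\<close> is injective on \<open>U\<close>; so \<open>\<pi>\<close> is a local diffeomorphism.  If the atlas of the given manifold is
  not closed under restriction to open subsets, these charts need not cover the quotient.\<close>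

definition orbit_manifold ::
    "('g, 'm) monoid_scheme \<Rightarrow> ('g \<Rightarrow> 'a \<Rightarrow> 'a) \<Rightarrow> ('a, 'e) manifold \<Rightarrow> ('a set, 'e) manifold" where
  "orbit_manifold G act = (\<lambda>(X, A).
     (quotient_topology X (orbit G act),
      {(orbit G act ` U, \<phi> \<circ> inv_into U (orbit G act)) | U \<phi>.
         (U, \<phi>) \<in> A \<and> inj_on (orbit G act) U}))"


section \<open>Lens spaces\<close>

text \<open>The coordinates \<open>(z\<^sub>1, \<dots>, z\<^sub>n, z\<^bsub>n+1\<^esub>)\<close> of \<open>\<complex>\<^bsup>n+1\<^esup>\<close> are represented by the pair of \<open>(z\<^sub>1, \<dots>, z\<^sub>n)\<close> and
  \<open>z\<^bsub>n+1\<^esub>\<close>.  As elements of the group \<open>integer_mod_group\<close>, the residue classes modulo \<open>p\<close> are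
  represented by the integers \<open>0, \<dots>, p - 1\<close>.\<close>

definition lens_action ::
    "int \<Rightarrow> (int ^ 'n::finite) \<Rightarrow> int \<Rightarrow> (complex ^ 'n) \<times> complex \<Rightarrow> (complex ^ 'n) \<times> complex" where
  "lens_action p q k = (\<lambda>z \<in> sphere 0 1.
     (\<chi> i. exp (2 * of_real pi * \<i> * of_int (k * (q $ i)) / of_int p) * (fst z $ i),
      exp (2 * of_real pi * \<i> * of_int k / of_int p) * snd z))"

text \<open>The sphere has dimension \<open>2n+1\<close>, so it is modelled on \<open>\<complex>\<^sup>n \<times> \<real>\<close>.\<close>

definition lens_space ::
    "int \<Rightarrow> (int ^ 'n::finite) \<Rightarrow> (((complex ^ 'n) \<times> complex) set, (complex ^ 'n) \<times> real) manifold" where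
  "lens_space p q =
     orbit_manifold (integer_mod_group (nat p)) (lens_action p q) (embedded_manifold (sphere 0 1))"

end

theory Submission
  imports Defs
begin

text \<open>
  The construction of \<open>r\<close> from \<open>q\<close> changes nothing modulo \<open>p\<close>: applying \<open>B\<close>, changing the result by
  multiples of \<open>p\<close> and applying \<open>B\<inverse>\<close>, which again has integer entries, yields \<open>r \<equiv> q (mod p)\<close>
  (\<open>modified_weights_cong\<close>). The action of \<open>k\<close> involves \<open>q\<^sub>i\<close> only through the \<open>p\<close>-th root of unity
  \<open>exp (2\<pi>\<i> k q\<^sub>i / p)\<close>, so \<open>q\<close> and \<open>r\<close> define the same action, and the two lens spaces are equal
  (\<open>lens_action_cong\<close>). The identity map is the diffeomorphism.

  What has substance is that the lens space is a smooth manifold, which \<^const>\<open>diffeomorphic\<close> demands.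
  This holds for the quotient of any subset of a Euclidean space that is covered by embedded charts by
  a finite group that acts freely by maps that locally extend to smooth ones (\<open>smooth_manifold_orbit_manifold\<close>).
  Finiteness makes the quotient Hausdorff, finiteness and freeness make the projection locally
  injective, and the changes of charts of the quotient are locally those of the given space composed
  with the action of a single group element. For lens spaces, the group elements act by linear
  isometries, freely because \<open>p\<close> is coprime to each \<open>q\<^sub>i\<close> (\<open>rotation_free\<close>), and the sphere is covered by
  orthogonal projections of hemispheres (\<open>unit_sphere_embedded_chart\<close>). Their inverses involve a square
  root, and the changes of charts are composites; so the closure properties of smooth functions,
  above all the chain rule, come first.
\<close>


section \<open>Calculus of continuously differentiable functions\<close>

lemma Ck_on_subset: "Ck_on k S f \<Longrightarrow> T \<subseteq> S \<Longrightarrow> Ck_on k T f"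
  by (induction k arbitrary: f) (auto intro: continuous_on_subset)

lemma Ck_on_SucD: "Ck_on (Suc k) S f \<Longrightarrow> Ck_on k S f"
proof (induction k arbitrary: f)
  case 0
  then show ?case
    by (auto intro!: continuous_at_imp_continuous_on differentiable_imp_continuous_within)
next
  case (Suc k)
  then show ?case
    by (metis Ck_on.simps(2))
qed

lemma Ck_on_cong:
  assumes "open S" "\<And>x. x \<in> S \<Longrightarrow> f x = g x" "Ck_on k S f"
  shows "Ck_on k S g"
  using assms(2,3)
proof (induction k arbitrary: f g)
  case 0
  then show ?case
    by (simp cong: continuous_on_cong)
next
  case (Suc k)
  have D: "g differentiable (at x)" if "x \<in> S" for x
    using Suc.prems \<open>open S\<close> that
    by (metis differentiable_def has_derivative_transform_within_open Ck_on.simps(2))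
  have "frechet_derivative f (at x) v = frechet_derivative g (at x) v" if "x \<in> S" for x v
    using Suc.prems \<open>open S\<close> that
    by (intro fun_cong[OF frechet_derivative_transform_within_open[of f x S g]]) auto
  then have "Ck_on k S (\<lambda>x. frechet_derivative g (at x) v)" for v
    using Suc.prems(2) by (intro Suc.IH[of "\<lambda>x. frechet_derivative f (at x) v"
          "\<lambda>x. frechet_derivative g (at x) v"]) simp_all
  with D show ?case
    by simp
qed

lemma Ck_on_SucI:
  assumes "open S" "\<And>x. x \<in> S \<Longrightarrow> (f has_derivative f' x) (at x)"
    "\<And>v. Ck_on k S (\<lambda>x. f' x v)"
  shows "Ck_on (Suc k) S f"
proof -
  have "f differentiable (at x)" if "x \<in> S" for x
    using assms(2)[OF that] by (auto simp: differentiable_def)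
  moreover have "f' x = frechet_derivative f (at x)" if "x \<in> S" for x
    by (rule frechet_derivative_at[OF assms(2)[OF that]])
  ultimately show ?thesis
    using assms(3) by (auto intro!: Ck_on_cong[OF \<open>open S\<close> _ assms(3)])
qed

text \<open>The derivative of a function at a point depends only on its germ there, so continuous
  differentiability may be tested on some neighbourhood of each point.\<close>

lemma Ck_on_local:
  assumes "\<And>x. x \<in> S \<Longrightarrow> \<exists>W. open W \<and> x \<in> W \<and> Ck_on k W f"
  shows "Ck_on k S f"
  using assms
proof (induction k arbitrary: f)
  case 0
  have "continuous (at x) f" if x: "x \<in> S" for x
  proof -
    obtain W where "open W" "x \<in> W" "continuous_on W f"
      using 0[OF x] by auto
    then show ?thesis
      by (simp add: continuous_on_eq_continuous_at)
  qed
  then show ?case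
    by (simp add: continuous_at_imp_continuous_on)
next
  case (Suc k)
  have "Ck_on k S (\<lambda>x. frechet_derivative f (at x) v)" for v
    using Suc.prems by (intro Suc.IH) (metis Ck_on.simps(2))
  then show ?case
    using Suc.prems by fastforce
qed

lemma Ck_on_const: "Ck_on k S (\<lambda>x. c)"
  by (induction k arbitrary: c) simp_all

lemma Ck_on_bounded_linear:
  assumes "bounded_linear L"
  shows "Ck_on k S L"
proof (cases k)
  case 0
  then show ?thesis
    using assms by (simp add: linear_continuous_on)
next
  case (Suc j)
  have D: "(L has_derivative L) (at x)" for x
    using assms by (simp add: bounded_linear_imp_has_derivative)
  then have "frechet_derivative L (at x) = L" for x
    by (metis frechet_derivative_at)
  then show ?thesis
    using D Suc by (auto simp: differentiable_def Ck_on_const)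
qed

lemma Ck_on_add:
  assumes "open S" "Ck_on k S f" "Ck_on k S g"
  shows "Ck_on k S (\<lambda>x. f x + g x)"
  using assms(2,3)
proof (induction k arbitrary: f g)
  case 0
  then show ?case
    by (simp add: continuous_on_add)
next
  case (Suc k)
  show ?case
    using Suc.prems
    by (intro Ck_on_SucI[OF \<open>open S\<close> has_derivative_add] Suc.IH)
      (auto simp: frechet_derivative_works)
qed

lemma Ck_on_sum:
  assumes "open S" "finite I" "\<And>i. i \<in> I \<Longrightarrow> Ck_on k S (f i)"
  shows "Ck_on k S (\<lambda>x. \<Sum>i\<in>I. f i x)"
  using assms(2,3) by (induction I) (auto intro: Ck_on_const Ck_on_add \<open>open S\<close>)

text \<open>The Leibniz rule, in the generality that covers scalar multiples, inner products and products
  of real functions at once.\<close>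

lemma Ck_on_bounded_bilinear:
  assumes "bounded_bilinear h" "open S" "Ck_on k S f" "Ck_on k S g"
  shows "Ck_on k S (\<lambda>x. h (f x) (g x))"
  using assms(3,4)
proof (induction k arbitrary: f g)
  case 0
  then show ?case
    using bounded_bilinear.continuous_on[OF assms(1)] by simp
next
  case (Suc k)
  have fg: "Ck_on k S f" "Ck_on k S g"
    using Suc.prems Ck_on_SucD by blast+
  show ?case
  proof (rule Ck_on_SucI[OF \<open>open S\<close> bounded_bilinear.FDERIV[OF assms(1)]])
    show "(f has_derivative frechet_derivative f (at x)) (at x)"
      and "(g has_derivative frechet_derivative g (at x)) (at x)" if "x \<in> S" for x
      using Suc.prems that by (auto simp: frechet_derivative_works)
    show "Ck_on k S (\<lambda>x. h (f x) (frechet_derivative g (at x) v) +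
        h (frechet_derivative f (at x) v) (g x))" for v
      using Suc.prems fg by (intro Ck_on_add[OF \<open>open S\<close>] Suc.IH) auto
  qed
qed

text \<open>The derivative of \<open>g \<circ> f\<close> in direction \<open>v\<close> is \<open>Dg (f x) (Df x v)\<close>, where the direction in which
  \<open>g\<close> is differentiated varies with \<open>x\<close>. Since \<^const>\<open>Ck_on\<close> speaks of fixed directions only, the
  derivative is expanded along the standard basis; then the induction hypothesis applies to
  \<open>f\<close> and the partial derivatives of \<open>g\<close>.\<close>

lemma Ck_on_compose:
  assumes "open S" "open T" "f ` S \<subseteq> T" "Ck_on k S f" "Ck_on k T g"
  shows "Ck_on k S (\<lambda>x. g (f x))"
  using assms(4,5)
proof (induction k arbitrary: g)
  case 0
  then show ?case
    using assms(3) by (auto intro: continuous_on_compose2)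
next
  case (Suc k)
  define Df Dg where "Df x = frechet_derivative f (at x)"
    and "Dg y = frechet_derivative g (at y)" for x y
  have Df: "(f has_derivative Df x) (at x)" if "x \<in> S" for x
    using Suc.prems(1) that by (simp add: frechet_derivative_works Df_def)
  have Dg: "(g has_derivative Dg y) (at y)" if "y \<in> T" for y
    using Suc.prems(2) that by (simp add: frechet_derivative_works Dg_def)
  have chain: "((\<lambda>x. g (f x)) has_derivative (\<lambda>v. Dg (f x) (Df x v))) (at x)" if "x \<in> S" for x
    using that assms(3) by (intro has_derivative_compose[OF Df Dg]) auto
  have expand: "(\<Sum>b\<in>Basis. (Df x v \<bullet> b) *\<^sub>R Dg (f x) b) = Dg (f x) (Df x v)"
    if "x \<in> S" for x v
  proof -
    have "linear (Dg (f x))"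
      using Dg[of "f x"] that assms(3) by (auto intro: has_derivative_linear)
    then have "(\<Sum>b\<in>Basis. (Df x v \<bullet> b) *\<^sub>R Dg (f x) b) =
        Dg (f x) (\<Sum>b\<in>Basis. (Df x v \<bullet> b) *\<^sub>R b)"
      by (simp add: linear_sum linear_scale)
    then show ?thesis
      by (simp add: euclidean_representation)
  qed
  have f: "Ck_on k S f"
    using Suc.prems(1) Ck_on_SucD by blast
  have "Ck_on k S (\<lambda>x. \<Sum>b\<in>Basis. (Df x v \<bullet> b) *\<^sub>R Dg (f x) b)" for v
    using Suc.prems
    by (intro Ck_on_sum Ck_on_bounded_bilinear[OF bounded_bilinear_scaleR]
        Ck_on_bounded_bilinear[OF bounded_bilinear_inner] Ck_on_const Suc.IH[OF f] \<open>open S\<close>)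
      (auto simp: Df_def Dg_def)
  then have "Ck_on k S (\<lambda>x. Dg (f x) (Df x v))" for v
    using Ck_on_cong[OF \<open>open S\<close>, of "\<lambda>x. \<Sum>b\<in>Basis. (Df x v \<bullet> b) *\<^sub>R Dg (f x) b"
        "\<lambda>x. Dg (f x) (Df x v)" k for v] expand by blast
  with chain show ?case
    by (intro Ck_on_SucI[OF \<open>open S\<close>, where f' = "\<lambda>x v. Dg (f x) (Df x v)"]) auto
qed

text \<open>The derivative of \<^term>\<open>inverse\<close> is a polynomial in \<^term>\<open>inverse\<close>, and the derivative of
  \<^term>\<open>sqrt\<close> is a multiple of \<open>inverse \<circ> sqrt\<close>; hence one more order of differentiability can
  always be gained.\<close>

lemma Ck_on_inverse: "Ck_on k {0<..} (inverse :: real \<Rightarrow> real)"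
proof (induction k)
  case 0
  show ?case
    by (simp add: continuous_on_inverse)
next
  case (Suc k)
  have "(inverse has_derivative (\<lambda>v. - (inverse x * v * inverse x))) (at x)"
    if "x \<in> {0<..}" for x :: real
    using that by (intro has_derivative_inverse') auto
  moreover have "Ck_on k {0<..} (\<lambda>x::real. - (inverse x * v * inverse x))" for v
  proof -
    have "Ck_on k {0<..} (\<lambda>x::real. (-v) * (inverse x * inverse x))"
      by (intro Ck_on_bounded_bilinear[OF bounded_bilinear_mult] Ck_on_const Suc.IH) auto
    then show ?thesis
      by (simp add: mult_ac)
  qed
  ultimately show ?case
    by (intro Ck_on_SucI[where f' = "\<lambda>x v. - (inverse x * v * inverse x)"]) auto
qed

lemma Ck_on_sqrt: "Ck_on k {0<..} sqrt"
proof (induction k)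
  case 0
  show ?case
    by (simp add: continuous_on_real_sqrt)
next
  case (Suc k)
  have "(sqrt has_derivative (*) (inverse (sqrt x) / 2)) (at x)" if "x \<in> {0<..}" for x
    using DERIV_real_sqrt[of x] that by (simp add: has_field_derivative_def)
  moreover have "Ck_on k {0<..} (\<lambda>x. inverse (sqrt x) / 2 * v)" for v
  proof -
    have "Ck_on k {0<..} (\<lambda>x. inverse (sqrt x) * (v / 2))"
      by (intro Ck_on_bounded_bilinear[OF bounded_bilinear_mult] Ck_on_const
          Ck_on_compose[OF _ _ _ Suc.IH Ck_on_inverse]) auto
    moreover have "inverse (sqrt x) * (v / 2) = inverse (sqrt x) / 2 * v" for x
      by simp
    ultimately show ?thesis
      by (simp only:)
  qed
  ultimately show ?case
    by (intro Ck_on_SucI[where f' = "\<lambda>x. (*) (inverse (sqrt x) / 2)"]) auto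
qed


section \<open>Smooth functions on subsets of Euclidean spaces\<close>

lemma smooth_on_subset: "smooth_on S f \<Longrightarrow> T \<subseteq> S \<Longrightarrow> smooth_on T f"
  unfolding smooth_on_def using Ck_on_subset by blast

lemma smooth_on_imp_continuous_on: "smooth_on S f \<Longrightarrow> continuous_on S f"
  unfolding smooth_on_def using Ck_on.simps(1) by blast

lemma smooth_on_cong:
  assumes "open S" "\<And>x. x \<in> S \<Longrightarrow> f x = g x" "smooth_on S f"
  shows "smooth_on S g"
  using Ck_on_cong[OF assms(1), of f g] assms(2,3) unfolding smooth_on_def by blast

lemma smooth_on_local:
  assumes "\<And>x. x \<in> S \<Longrightarrow> \<exists>W. open W \<and> x \<in> W \<and> smooth_on W f"
  shows "smooth_on S f"
  unfolding smooth_on_def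
proof
  fix k
  show "Ck_on k S f"
    by (rule Ck_on_local) (meson assms smooth_on_def)
qed

lemma smooth_on_compose:
  assumes "open S" "open T" "f ` S \<subseteq> T" "smooth_on S f" "smooth_on T g"
  shows "smooth_on S (\<lambda>x. g (f x))"
  using assms Ck_on_compose[OF assms(1-3), of _ g] by (simp add: smooth_on_def)

lemma extends_smoothly_onD:
  assumes "extends_smoothly_on S f" "x \<in> S"
  shows "\<exists>W F. open W \<and> x \<in> W \<and> smooth_on W F \<and> (\<forall>y\<in>S \<inter> W. F y = f y)"
  using assms unfolding extends_smoothly_on_def by (rule bspec)

lemma extends_smoothly_on_subset:
  assumes "extends_smoothly_on S f" "T \<subseteq> S"
  shows "extends_smoothly_on T f"
  unfolding extends_smoothly_on_def
proof
  fix x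
  assume "x \<in> T"
  then obtain W F where "open W" "x \<in> W" "smooth_on W F" "\<forall>y\<in>S \<inter> W. F y = f y"
    using assms unfolding extends_smoothly_on_def by blast
  then show "\<exists>W F. open W \<and> x \<in> W \<and> smooth_on W F \<and> (\<forall>y\<in>T \<inter> W. F y = f y)"
    using assms(2) by blast
qed

lemma bounded_linear_extends_smoothly_on:
  assumes "bounded_linear L" "\<And>x. x \<in> S \<Longrightarrow> L x = f x"
  shows "extends_smoothly_on S f"
  unfolding extends_smoothly_on_def
proof
  fix x
  have "smooth_on UNIV L"
    by (simp add: smooth_on_def Ck_on_bounded_linear assms(1))
  then show "\<exists>W F. open W \<and> x \<in> W \<and> smooth_on W F \<and> (\<forall>y\<in>S \<inter> W. F y = f y)"
    using assms(2) open_UNIV by blast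
qed

lemma extends_smoothly_on_imp_continuous_on:
  assumes "extends_smoothly_on S f"
  shows "continuous_on S f"
  unfolding continuous_on_eq_continuous_within
proof
  fix x
  assume x: "x \<in> S"
  obtain W F where W: "open W" "x \<in> W" "smooth_on W F"
    and F: "\<forall>y\<in>S \<inter> W. F y = f y"
    using extends_smoothly_onD[OF assms x] by (elim exE conjE)
  have "continuous (at x within S) F"
    using W smooth_on_imp_continuous_on continuous_at_imp_continuous_within
      continuous_on_eq_continuous_at by blast
  then show "continuous (at x within S) f"
    by (rule continuous_transform_within_openin[where S = "S \<inter> W"])
      (use W x F in \<open>auto intro: openin_open_Int\<close>)
qed

text \<open>Near each point a local extension of \<open>f\<close> can be used in its place, and then the chain rule
  applies. With the inverse of a chart as \<open>g\<close>, this is how maps between subsets are read off in charts.\<close>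

lemma smooth_on_compose_extends_smoothly:
  assumes "open N" "smooth_on N g" "g ` N \<subseteq> S" "extends_smoothly_on S f"
  shows "smooth_on N (\<lambda>x. f (g x))"
proof (rule smooth_on_local)
  fix x
  assume x: "x \<in> N"
  then have "g x \<in> S"
    using assms(3) by blast
  from extends_smoothly_onD[OF assms(4) this] obtain W F
    where W: "open W" "g x \<in> W" "smooth_on W F"
      and F: "\<forall>y\<in>S \<inter> W. F y = f y"
    by (elim exE conjE)
  define N' where "N' = N \<inter> g -` W"
  have N': "open N'"
    unfolding N'_def
    using smooth_on_imp_continuous_on[OF assms(2)] assms(1) W(1)
    by (rule continuous_open_preimage)
  have "smooth_on N' (\<lambda>x. F (g x))"
    using N' W(1,3) smooth_on_subset[OF assms(2)]
    by (intro smooth_on_compose[of N' W g F]) (auto simp: N'_def)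
  moreover have "F (g y) = f (g y)" if "y \<in> N'" for y
    using that assms(3) F by (auto simp: N'_def)
  ultimately have "smooth_on N' (\<lambda>x. f (g x))"
    using smooth_on_cong[OF N', of "\<lambda>x. F (g x)" "\<lambda>x. f (g x)"] by simp
  with N' x W show "\<exists>W. open W \<and> x \<in> W \<and> smooth_on W (\<lambda>x. f (g x))"
    unfolding N'_def by blast
qed

lemma extends_smoothly_on_compose:
  assumes "extends_smoothly_on S f" "f ` S \<subseteq> T" "extends_smoothly_on T g"
  shows "extends_smoothly_on S (\<lambda>x. g (f x))"
  unfolding extends_smoothly_on_def
proof
  fix x
  assume x: "x \<in> S"
  from extends_smoothly_onD[OF assms(1) x] obtain W F
    where W: "open W" "x \<in> W" "smooth_on W F"
      and F: "\<forall>y\<in>S \<inter> W. F y = f y"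
    by (elim exE conjE)
  have "f x \<in> T"
    using x assms(2) by blast
  from extends_smoothly_onD[OF assms(3) this] obtain V G
    where V: "open V" "f x \<in> V" "smooth_on V G"
      and G: "\<forall>y\<in>T \<inter> V. G y = g y"
    by (elim exE conjE)
  define N where "N = W \<inter> F -` V"
  have N: "open N"
    unfolding N_def
    using smooth_on_imp_continuous_on[OF W(3)] W(1) V(1) by (rule continuous_open_preimage)
  have "smooth_on N (\<lambda>x. G (F x))"
    using N V(1,3) smooth_on_subset[OF W(3)] by (intro smooth_on_compose[of N V F G]) (auto simp: N_def)
  moreover have "G (F y) = g (f y)" if "y \<in> S \<inter> N" for y
  proof -
    have "F y = f y" "f y \<in> T"
      using that assms(2) F by (auto simp: N_def)
    then show ?thesis
      using that G by (auto simp: N_def)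
  qed
  moreover have "x \<in> N"
    using W V x F by (simp add: N_def)
  ultimately show "\<exists>W F. open W \<and> x \<in> W \<and> smooth_on W F \<and> (\<forall>y\<in>S \<inter> W. F y = g (f y))"
    using N by blast
qed

section \<open>Charts of embedded manifolds and of the sphere\<close>

text \<open>The members of the atlas of \<^const>\<open>embedded_manifold\<close>.\<close>

definition embedded_chart ::
    "'a::euclidean_space set \<Rightarrow> 'a set \<Rightarrow> ('a \<Rightarrow> 'e::euclidean_space) \<Rightarrow> bool" where
  "embedded_chart S U \<phi> \<longleftrightarrow>
     openin (top_of_set S) U \<and> inj_on \<phi> U \<and> extends_smoothly_on U \<phi> \<and>
     open (\<phi> ` U) \<and> smooth_on (\<phi> ` U) (inv_into U \<phi>)"

lemma embedded_manifold_eq: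
  "embedded_manifold S = (top_of_set S, {(U, \<phi>). embedded_chart S U \<phi>})"
  by (simp add: embedded_manifold_def embedded_chart_def)

lemma embedded_chart_homeomorphic_map:
  assumes "embedded_chart S U \<phi>"
  shows "homeomorphic_map (top_of_set U) (top_of_set (\<phi> ` U)) \<phi>"
proof -
  have "continuous_on U \<phi>" "continuous_on (\<phi> ` U) (inv_into U \<phi>)" "inj_on \<phi> U"
    using assms extends_smoothly_on_imp_continuous_on smooth_on_imp_continuous_on
    unfolding embedded_chart_def by blast+
  then have "homeomorphic_maps (top_of_set U) (top_of_set (\<phi> ` U)) \<phi> (inv_into U \<phi>)"
    unfolding homeomorphic_maps_def by (auto simp: inv_into_into)
  then show ?thesis
    using homeomorphic_map_maps by blast
qed

lemma embedded_chart_open_image: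
  assumes "embedded_chart S U \<phi>" "openin (top_of_set S) U'" "U' \<subseteq> U"
  shows "open (\<phi> ` U')"
proof -
  have "openin (top_of_set U) U'"
    using assms(1-3) openin_imp_subset unfolding embedded_chart_def
    by (metis openin_subset_trans)
  then have "openin (top_of_set (\<phi> ` U)) (\<phi> ` U')"
    using embedded_chart_homeomorphic_map[OF assms(1)]
    by (metis homeomorphic_imp_open_map open_map_def)
  then show ?thesis
    using assms(1) openin_open_eq unfolding embedded_chart_def by blast
qed

text \<open>With this, a chart around a point can be shrunk until the projection to the orbits is injective
  on it, as the charts of an orbit manifold require.\<close>

lemma embedded_chart_restrict:
  assumes "embedded_chart S U \<phi>" "openin (top_of_set S) U'" "U' \<subseteq> U"
  shows "embedded_chart S U' \<phi>"
proof -
  have inj: "inj_on \<phi> U"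
    using assms(1) unfolding embedded_chart_def by blast
  have op: "open (\<phi> ` U')"
    using embedded_chart_open_image[OF assms] .
  have "smooth_on (\<phi> ` U') (inv_into U \<phi>)"
    using assms(1,3) smooth_on_subset unfolding embedded_chart_def by blast
  moreover have "inv_into U \<phi> w = inv_into U' \<phi> w" if "w \<in> \<phi> ` U'" for w
    using that inj assms(3) inj_on_subset[OF inj assms(3)] by (auto simp: subset_iff)
  ultimately have "smooth_on (\<phi> ` U') (inv_into U' \<phi>)"
    using smooth_on_cong[OF op] by blast
  then show ?thesis
    using assms op inj_on_subset[OF inj] extends_smoothly_on_subset
    unfolding embedded_chart_def by blast
qed

text \<open>On the open hemisphere centred at \<open>x\<close>, the orthogonal projection to the hyperplane \<open>x\<^sup>\<bottom>\<close> is a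
  chart onto the open unit ball of that hyperplane; its inverse sends \<open>w\<close> to \<open>w + sqrt (1 - w \<bullet> w) x\<close>. A linear isometry
  from \<open>x\<^sup>\<bottom>\<close> transports this chart to the model space, whichever space of the right dimension that is.\<close>

lemma unit_sphere_embedded_chart:
  fixes x :: "'a::euclidean_space"
  assumes x: "x \<in> sphere 0 1" and dim: "DIM('a) = Suc DIM('e)"
  shows "\<exists>U (\<phi> :: 'a \<Rightarrow> 'e::euclidean_space). x \<in> U \<and> embedded_chart (sphere 0 1) U \<phi>"
proof -
  have xx: "x \<bullet> x = 1"
    using x by (simp add: norm_eq_1)
  define H where "H = {y. x \<bullet> y = 0}"
  have "dim H = dim (UNIV :: 'e set)"
    using dim_hyperplane[of x] xx dim by (cases "x = 0") (auto simp: H_def)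
  moreover have "subspace H"
    unfolding H_def by (rule subspace_hyperplane)
  ultimately obtain f :: "'a \<Rightarrow> 'e" and g :: "'e \<Rightarrow> 'a" where
    lf: "linear f" and lg: "linear g" and gH: "range g = H"
    and nf: "\<And>y. y \<in> H \<Longrightarrow> norm (f y) = norm y" and ng: "\<And>w. w \<in> UNIV \<Longrightarrow> norm (g w) = norm w"
    and gf: "\<And>y. y \<in> H \<Longrightarrow> g (f y) = y" and fg: "\<And>w. w \<in> UNIV \<Longrightarrow> f (g w) = w"
    using isometries_subspaces[OF _ subspace_UNIV, of H] by metis
  define U where "U = {y \<in> sphere 0 1. 0 < x \<bullet> y}"
  define P where "P y = y - (x \<bullet> y) *\<^sub>R x" for y
  define \<phi> where "\<phi> y = f (P y)" for y
  define j where "j w = g w + sqrt (1 - w \<bullet> w) *\<^sub>R x" for w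
  have PH: "P y \<in> H" for y
    by (simp add: P_def H_def inner_diff_right xx)
  have xg: "x \<bullet> g w = 0" for w
    using gH by (auto simp: H_def)
  then have gx: "g w \<bullet> x = 0" for w
    by (simp add: inner_commute)
  have gg: "g w \<bullet> g w = w \<bullet> w" for w
    using ng[of w] by (simp add: norm_eq)
  have ball: "w \<in> ball 0 1 \<longleftrightarrow> w \<bullet> w < 1" for w :: 'e
    by (simp add: norm_lt_square)
  have \<phi>\<phi>: "\<phi> y \<bullet> \<phi> y = 1 - (x \<bullet> y)\<^sup>2" if "y \<in> U" for y
  proof -
    have "\<phi> y \<bullet> \<phi> y = P y \<bullet> P y"
      using nf[OF PH[of y]] by (simp add: \<phi>_def norm_eq)
    also have "\<dots> = 1 - (x \<bullet> y)\<^sup>2"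
      using that by (simp add: P_def U_def inner_diff_left inner_diff_right xx norm_eq_1
          inner_commute power2_eq_square)
    finally show ?thesis .
  qed
  have 1: "\<phi> y \<in> ball 0 1 \<and> j (\<phi> y) = y" if "y \<in> U" for y
  proof
    show "\<phi> y \<in> ball 0 1"
      using that unfolding ball \<phi>\<phi>[OF that] by (simp add: U_def)
    have "j (\<phi> y) = P y + sqrt ((x \<bullet> y)\<^sup>2) *\<^sub>R x"
      unfolding j_def \<phi>\<phi>[OF that] by (simp add: \<phi>_def gf[OF PH])
    then show "j (\<phi> y) = y"
      using that by (simp add: P_def U_def)
  qed
  have 2: "j w \<in> U \<and> \<phi> (j w) = w" if "w \<in> ball 0 1" for w
  proof -
    have w: "w \<bullet> w < 1"
      using that ball by blast
    have xj: "x \<bullet> j w = sqrt (1 - w \<bullet> w)"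
      by (simp add: j_def inner_add_right xg xx)
    have "j w \<bullet> j w = 1"
      using w by (simp add: j_def inner_add_left inner_add_right xg gx gg xx)
    then have "j w \<in> U"
      using w xj by (simp add: U_def norm_eq_1)
    moreover have "\<phi> (j w) = w"
      unfolding \<phi>_def P_def xj by (simp add: j_def fg)
    ultimately show ?thesis ..
  qed
  have img: "\<phi> ` U = ball 0 1"
    using 1 2 by force
  have inj: "inj_on \<phi> U"
    using 1 by (metis inj_onI)
  have inv: "j w = inv_into U \<phi> w" if "w \<in> ball 0 1" for w
    using 2[OF that] inj by (metis inv_into_f_f)
  have "smooth_on (ball 0 1) j"
    unfolding smooth_on_def j_def
  proof
    fix k
    have "Ck_on k (ball 0 1) (\<lambda>w::'e. 1 + (- 1) *\<^sub>R (w \<bullet> w))"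
      by (intro Ck_on_add Ck_on_const Ck_on_bounded_bilinear[OF bounded_bilinear_scaleR]
          Ck_on_bounded_bilinear[OF bounded_bilinear_inner]
          Ck_on_bounded_linear[OF bounded_linear_ident]) auto
    then have "Ck_on k (ball 0 1) (\<lambda>w::'e. 1 - w \<bullet> w)"
      by simp
    moreover have "(\<lambda>w::'e. 1 - w \<bullet> w) ` ball 0 1 \<subseteq> {0<..}"
      using ball by auto
    ultimately have "Ck_on k (ball 0 1) (\<lambda>w::'e. sqrt (1 - w \<bullet> w))"
      by (intro Ck_on_compose[OF _ _ _ _ Ck_on_sqrt]) auto
    then show "Ck_on k (ball 0 1) (\<lambda>w. g w + sqrt (1 - w \<bullet> w) *\<^sub>R x)"
      using Ck_on_bounded_linear[OF lg[unfolded linear_conv_bounded_linear]]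
      by (intro Ck_on_add Ck_on_const Ck_on_bounded_bilinear[OF bounded_bilinear_scaleR]) auto
  qed
  then have "smooth_on (\<phi> ` U) (inv_into U \<phi>)"
    unfolding img by (intro smooth_on_cong[OF open_ball, of 0 1 j "inv_into U \<phi>"] inv)
  moreover have "extends_smoothly_on U \<phi>"
  proof (rule bounded_linear_extends_smoothly_on)
    have "bounded_linear P"
      unfolding P_def
      by (intro bounded_linear_sub bounded_linear_ident bounded_linear_scaleR_const
          bounded_linear_inner_right)
    then show "bounded_linear (\<lambda>y. f (P y))"
      by (rule bounded_linear_compose[OF lf[unfolded linear_conv_bounded_linear]])
  qed (simp add: \<phi>_def)
  moreover have "openin (top_of_set (sphere 0 1)) U"
  proof -
    have "U = sphere 0 1 \<inter> {y. x \<bullet> y > 0}"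
      by (auto simp: U_def)
    then show ?thesis
      by (simp add: openin_open_Int open_halfspace_gt)
  qed
  moreover have "open (\<phi> ` U)"
    by (simp add: img)
  moreover have "x \<in> U"
    using x xx by (simp add: U_def)
  ultimately show ?thesis
    using inj unfolding embedded_chart_def by blast
qed


section \<open>Quotients by free actions of finite groups\<close>

locale free_smooth_action = group_action G S act
  for G (structure) and S :: "'a::euclidean_space set" and act +
  assumes finite_group: "finite (carrier G)"
    and act_smooth: "g \<in> carrier G \<Longrightarrow> extends_smoothly_on S (act g)"
    and act_free: "g \<in> carrier G \<Longrightarrow> x \<in> S \<Longrightarrow> act g x = x \<Longrightarrow> g = \<one>"
begin

abbreviation \<pi> :: "'a \<Rightarrow> 'a set" where
  "\<pi> \<equiv> orbit G act"

abbreviation quot :: "'a set topology" where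
  "quot \<equiv> quotient_topology (top_of_set S) \<pi>"

lemma act_closed: "g \<in> carrier G \<Longrightarrow> x \<in> S \<Longrightarrow> act g x \<in> S"
  using element_image by blast

text \<open>Every argument about the quotient below turns an equation between orbits into a group element
  by this rule.\<close>

lemma orbit_eq_iff:
  assumes x: "x \<in> S" and y: "y \<in> S"
  shows "\<pi> x = \<pi> y \<longleftrightarrow> (\<exists>g\<in>carrier G. act g x = y)"
proof
  assume "\<pi> x = \<pi> y"
  then have "y \<in> \<pi> x"
    using orbit_refl[OF y] by simp
  then show "\<exists>g\<in>carrier G. act g x = y"
    unfolding orbit_def by blast
next
  assume "\<exists>g\<in>carrier G. act g x = y"
  then have yx: "y \<in> \<pi> x"
    unfolding orbit_def by blast
  have sub: "\<pi> z \<subseteq> S" if "z \<in> S" for z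
    using that act_closed unfolding orbit_def by blast
  have xy: "x \<in> \<pi> y"
    using orbit_sym[OF x y yx] .
  show "\<pi> x = \<pi> y"
  proof
    show "\<pi> x \<subseteq> \<pi> y"
      using orbit_trans[OF y x _ xy] sub[OF x] by blast
    show "\<pi> y \<subseteq> \<pi> x"
      using orbit_trans[OF x y _ yx] sub[OF y] by blast
  qed
qed

lemma orbit_act: "g \<in> carrier G \<Longrightarrow> x \<in> S \<Longrightarrow> \<pi> (act g x) = \<pi> x"
  using orbit_eq_iff[of x "act g x"] act_closed[of g x] by blast

lemma openin_act_preimage:
  assumes "g \<in> carrier G" "openin (top_of_set S) V"
  shows "openin (top_of_set S) {x \<in> S. act g x \<in> V}"
proof -
  have "continuous_on S (act g)"
    using act_smooth[OF assms(1)] by (rule extends_smoothly_on_imp_continuous_on)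
  moreover have "act g \<in> S \<rightarrow> S"
    using act_closed[OF assms(1)] by blast
  ultimately have "openin (top_of_set S) (S \<inter> act g -` V)"
    using assms(2) by (rule continuous_openin_preimage)
  moreover have "S \<inter> act g -` V = {x \<in> S. act g x \<in> V}"
    by blast
  ultimately show ?thesis
    by simp
qed

lemma topspace_quot: "topspace quot = \<pi> ` S"
  using quotient_imp_surjective_map[OF quotient_map_quotient_topology] by (metis topspace_euclidean_subtopology)

lemma continuous_map_projection: "continuous_map (top_of_set S) quot \<pi>"
  using quotient_imp_continuous_map[OF quotient_map_quotient_topology] .

text \<open>The saturation of an open set \<open>U\<close> is the union of the translates of \<open>U\<close>, hence open.\<close>

lemma open_map_projection: "open_map (top_of_set S) quot \<pi>"
  unfolding open_map_def
proof (intro allI impI)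
  fix U
  assume U: "openin (top_of_set S) U"
  then have US: "U \<subseteq> S"
    using openin_imp_subset by blast
  have "{x \<in> S. \<pi> x \<in> \<pi> ` U} = (\<Union>g\<in>carrier G. {x \<in> S. act g x \<in> U})"
  proof (intro equalityI subsetI)
    fix x
    assume "x \<in> {x \<in> S. \<pi> x \<in> \<pi> ` U}"
    then obtain u where "x \<in> S" "u \<in> U" "\<pi> x = \<pi> u"
      by blast
    then show "x \<in> (\<Union>g\<in>carrier G. {x \<in> S. act g x \<in> U})"
      using US orbit_eq_iff[of x u] by auto
  next
    fix x
    assume "x \<in> (\<Union>g\<in>carrier G. {x \<in> S. act g x \<in> U})"
    then obtain g where "g \<in> carrier G" "x \<in> S" "act g x \<in> U"
      by blast
    then show "x \<in> {x \<in> S. \<pi> x \<in> \<pi> ` U}"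
      using orbit_act[of g x] by (auto intro: image_eqI[of _ _ "act g x"])
  qed
  moreover have "openin (top_of_set S) (\<Union>g\<in>carrier G. {x \<in> S. act g x \<in> U})"
    using openin_act_preimage U by blast
  ultimately show "openin quot (\<pi> ` U)"
    using US by (auto simp: openin_quotient_topology)
qed

lemma openin_Ball_group:
  assumes "\<And>g. g \<in> I \<Longrightarrow> openin (top_of_set S) (A g)" "I \<subseteq> carrier G"
  shows "openin (top_of_set S) {x \<in> S. \<forall>g\<in>I. x \<in> A g}"
proof -
  have "finite I"
    using assms(2) finite_group by (rule finite_subset)
  then have "openin (top_of_set S) ((\<Inter>g\<in>I. A g) \<inter> topspace (top_of_set S))"
    using assms(1) by (rule openin_INT)
  moreover have "(\<Inter>g\<in>I. A g) \<inter> topspace (top_of_set S) = {x \<in> S. \<forall>g\<in>I. x \<in> A g}"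
    by auto
  ultimately show ?thesis
    by simp
qed

text \<open>Given points \<open>x\<close> and \<open>y\<close> of different orbits, separate \<open>x\<close> from \<open>g y\<close> for each \<open>g\<close>. As the group is
  finite, the neighbourhoods of \<open>x\<close> and the translates back of those of \<open>g y\<close> can be intersected,
  and no translate of a point near \<open>y\<close> is near \<open>x\<close>.\<close>

lemma Hausdorff_space_quot: "Hausdorff_space quot"
  unfolding Hausdorff_space_def
proof (intro allI impI, elim conjE)
  fix a b
  assume "a \<in> topspace quot" "b \<in> topspace quot" and ab: "a \<noteq> b"
  then obtain x y where x: "x \<in> S" "a = \<pi> x" and y: "y \<in> S" "b = \<pi> y"
    unfolding topspace_quot by blast
  have "\<exists>A B. open A \<and> open B \<and> x \<in> A \<and> act g y \<in> B \<and> A \<inter> B = {}" if "g \<in> carrier G" for g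
  proof (rule hausdorff)
    show "x \<noteq> act g y"
      using that x y ab orbit_act by metis
  qed
  then obtain A B where AB: "\<And>g. g \<in> carrier G \<Longrightarrow>
      open (A g) \<and> open (B g) \<and> x \<in> A g \<and> act g y \<in> B g \<and> A g \<inter> B g = {}"
    by metis
  define U where "U = {u \<in> S. \<forall>g\<in>carrier G. u \<in> S \<inter> A g}"
  define V where "V = {v \<in> S. \<forall>g\<in>carrier G. v \<in> {v \<in> S. act g v \<in> S \<inter> B g}}"
  have "openin (top_of_set S) U"
    unfolding U_def using AB by (intro openin_Ball_group openin_open_Int) auto
  moreover have "openin (top_of_set S) V"
    unfolding V_def using AB
    by (intro openin_Ball_group openin_act_preimage openin_open_Int) auto
  moreover have "\<pi> ` U \<inter> \<pi> ` V = {}"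
  proof (rule ccontr)
    assume "\<pi> ` U \<inter> \<pi> ` V \<noteq> {}"
    then obtain u v where uv: "u \<in> U" "v \<in> V" "\<pi> v = \<pi> u"
      by (metis (no_types, opaque_lifting) disjoint_iff imageE)
    then obtain g where "g \<in> carrier G" "act g v = u"
      using orbit_eq_iff[of v u] by (auto simp: U_def V_def)
    then show False
      using uv AB[of g] by (auto simp: U_def V_def)
  qed
  moreover have "x \<in> U" "y \<in> V"
    using x y AB act_closed by (auto simp: U_def V_def)
  ultimately show "\<exists>U V. openin quot U \<and> openin quot V \<and> a \<in> U \<and> b \<in> V \<and> disjnt U V"
    using open_map_projection x y unfolding open_map_def disjnt_def
    by (intro exI[of _ "\<pi> ` U"] exI[of _ "\<pi> ` V"]) simp
qed

lemma second_countable_quot: "second_countable quot"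
proof (rule second_countable_open_map_image)
  have "second_countable (euclidean :: 'a topology)"
    unfolding second_countable_def
    by (metis open_openin topological_basis_def topological_basisE univ_second_countable)
  then show "second_countable (top_of_set S)"
    by (rule second_countable_subtopology)
qed (use continuous_map_projection open_map_projection topspace_quot in auto)

text \<open>The same argument with \<open>y = x\<close>: freeness separates \<open>x\<close> from \<open>g x\<close> for every \<open>g\<close> other than the
  identity, and this leaves a neighbourhood that is disjoint from all its other translates.\<close>

lemma projection_locally_injective:
  assumes x: "x \<in> S"
  shows "\<exists>N. openin (top_of_set S) N \<and> x \<in> N \<and> inj_on \<pi> N"
proof -
  define I where "I = carrier G - {\<one>}"
  have "\<exists>A B. open A \<and> open B \<and> x \<in> A \<and> act g x \<in> B \<and> A \<inter> B = {}" if "g \<in> I" for g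
  proof (rule hausdorff)
    show "x \<noteq> act g x"
      using that x act_free[of g x] by (auto simp: I_def)
  qed
  then obtain A B where AB: "\<And>g. g \<in> I \<Longrightarrow>
      open (A g) \<and> open (B g) \<and> x \<in> A g \<and> act g x \<in> B g \<and> A g \<inter> B g = {}"
    by metis
  define N where "N = {u \<in> S. \<forall>g\<in>I. u \<in> (S \<inter> A g) \<inter> {u \<in> S. act g u \<in> S \<inter> B g}}"
  have "openin (top_of_set S) N"
    unfolding N_def using AB
    by (intro openin_Ball_group openin_Int openin_act_preimage openin_open_Int) (auto simp: I_def)
  moreover have "x \<in> N"
    using x AB act_closed by (auto simp: N_def I_def)
  moreover have "inj_on \<pi> N"
  proof (rule inj_onI)
    fix u v
    assume uv: "u \<in> N" "v \<in> N" "\<pi> u = \<pi> v"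
    then obtain g where g: "g \<in> carrier G" "act g u = v"
      using orbit_eq_iff[of u v] by (auto simp: N_def)
    have "g \<notin> I"
      using uv g AB[of g] by (auto simp: N_def)
    then have "g = \<one>"
      using g by (simp add: I_def)
    then show "u = v"
      using g uv id_eq_one by (metis (no_types, lifting) N_def mem_Collect_eq restrict_apply')
  qed
  ultimately show ?thesis
    by blast
qed

text \<open>On an open set on which it is injective, the open continuous projection is a homeomorphism
  onto its image; so its inverse can be composed with a chart.\<close>

lemma orbit_chart_is_chart:
  assumes chart: "embedded_chart S U \<phi>" and inj: "inj_on \<pi> U"
  shows "is_chart quot (\<pi> ` U, \<phi> \<circ> inv_into U \<pi>)"
proof -
  have U: "openin (top_of_set S) U"
    using chart unfolding embedded_chart_def by blast
  then have US: "U \<subseteq> S"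
    using openin_imp_subset by blast
  have topU: "subtopology (top_of_set S) U = top_of_set U"
    using US by (simp add: subtopology_subtopology inf.absorb2)
  have \<pi>U: "openin quot (\<pi> ` U)"
    using U open_map_projection unfolding open_map_def by blast
  have img: "(\<phi> \<circ> inv_into U \<pi>) ` (\<pi> ` U) = \<phi> ` U"
    using inj by force
  have top\<pi>U: "topspace (subtopology quot (\<pi> ` U)) = \<pi> ` U"
    using US by (auto simp: topspace_quot)
  have "homeomorphic_map (top_of_set U) (subtopology quot (\<pi> ` U)) \<pi>"
  proof (rule bijective_open_imp_homeomorphic_map)
    show "continuous_map (top_of_set U) (subtopology quot (\<pi> ` U)) \<pi>"
      using continuous_map_from_subtopology[OF continuous_map_projection, of U]
      by (auto simp: topU continuous_map_in_subtopology)
    show "open_map (top_of_set U) (subtopology quot (\<pi> ` U)) \<pi>"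
      unfolding open_map_def
    proof (intro allI impI)
      fix W
      assume "openin (top_of_set U) W"
      then have "openin (top_of_set S) W" "W \<subseteq> U"
        using openin_open_subtopology[OF U] by (auto simp: topU)
      then show "openin (subtopology quot (\<pi> ` U)) (\<pi> ` W)"
        using open_map_projection unfolding open_map_def
        by (intro subset_openin_subtopology) auto
    qed
    show "\<pi> ` topspace (top_of_set U) = topspace (subtopology quot (\<pi> ` U))"
      unfolding top\<pi>U by simp
    show "inj_on \<pi> (topspace (top_of_set U))"
      using inj by simp
  qed
  then obtain \<sigma> where "homeomorphic_maps (top_of_set U) (subtopology quot (\<pi> ` U)) \<pi> \<sigma>"
    using homeomorphic_map_maps by blast
  then have \<sigma>: "homeomorphic_map (subtopology quot (\<pi> ` U)) (top_of_set U) \<sigma>"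
    and \<sigma>\<pi>: "\<And>u. u \<in> U \<Longrightarrow> \<sigma> (\<pi> u) = u"
    unfolding homeomorphic_maps_map by auto
  have "homeomorphic_map (subtopology quot (\<pi> ` U)) (top_of_set U) (inv_into U \<pi>)"
  proof (rule homeomorphic_map_eq[OF \<sigma>], unfold top\<pi>U)
    show "\<sigma> a = inv_into U \<pi> a" if "a \<in> \<pi> ` U" for a
      using that \<sigma>\<pi> inj by auto
  qed
  then have "homeomorphic_map (subtopology quot (\<pi> ` U)) (top_of_set (\<phi> ` U)) (\<phi> \<circ> inv_into U \<pi>)"
    using embedded_chart_homeomorphic_map[OF chart] by (rule homeomorphic_map_compose)
  then show ?thesis
    using \<pi>U chart unfolding is_chart_def embedded_chart_def prod.case img by blast
qed

text \<open>Two points \<open>u \<in> U\<close> and \<open>v \<in> V\<close> over the same orbit satisfy \<open>v = g u\<close> for some \<open>g\<close>. Near the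
  coordinates of \<open>u\<close> the change of charts is therefore \<open>\<psi> \<circ> g \<circ> \<phi>\<inverse>\<close>, with this fixed \<open>g\<close>; which \<open>g\<close>
  is needed may depend on the component of the overlap, so smoothness is shown locally.\<close>

lemma orbit_chart_transition_smooth:
  assumes chartU: "embedded_chart S U \<phi>" and injU: "inj_on \<pi> U"
    and chartV: "embedded_chart S V \<psi>" and injV: "inj_on \<pi> V"
  shows "smooth_on ((\<phi> \<circ> inv_into U \<pi>) ` (\<pi> ` U \<inter> \<pi> ` V))
    ((\<psi> \<circ> inv_into V \<pi>) \<circ> inv_into (\<pi> ` U) (\<phi> \<circ> inv_into U \<pi>))"
proof (rule smooth_on_local)
  have U: "openin (top_of_set S) U" "inj_on \<phi> U" "smooth_on (\<phi> ` U) (inv_into U \<phi>)"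
    and V: "openin (top_of_set S) V" "extends_smoothly_on V \<psi>"
    using chartU chartV unfolding embedded_chart_def by blast+
  have US: "U \<subseteq> S" and VS: "V \<subseteq> S"
    using U(1) V(1) openin_imp_subset by blast+
  fix w
  assume "w \<in> (\<phi> \<circ> inv_into U \<pi>) ` (\<pi> ` U \<inter> \<pi> ` V)"
  then obtain a where a: "a \<in> \<pi> ` U" "a \<in> \<pi> ` V" and w: "w = \<phi> (inv_into U \<pi> a)"
    by auto
  define u v where "u = inv_into U \<pi> a" and "v = inv_into V \<pi> a"
  have u: "u \<in> U" "w = \<phi> u" and v: "v \<in> V" "\<pi> u = \<pi> v"
    using a w by (simp_all add: u_def v_def inv_into_into f_inv_into_f)
  then obtain g where g: "g \<in> carrier G" "act g u = v"
    using orbit_eq_iff[of u v] US VS by blast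
  \<comment> \<open>The points of \<open>U\<close> that this \<open>g\<close> carries into \<open>V\<close>.\<close>
  define N where "N = U \<inter> {x \<in> S. act g x \<in> V}"
  have N: "openin (top_of_set S) N"
    unfolding N_def using U(1) openin_act_preimage[OF g(1) V(1)] by (rule openin_Int)
  have NU: "N \<subseteq> U"
    by (simp add: N_def)
  have op: "open (\<phi> ` N)"
    using embedded_chart_open_image[OF chartU N NU] .
  have sm: "smooth_on (\<phi> ` N) (\<lambda>w. \<psi> (act g (inv_into U \<phi> w)))"
  proof (rule smooth_on_compose_extends_smoothly[OF op, where g = "inv_into U \<phi>" and S = N
        and f = "\<lambda>x. \<psi> (act g x)"])
    show "smooth_on (\<phi> ` N) (inv_into U \<phi>)"
      using U(3) NU smooth_on_subset by blast
    show "inv_into U \<phi> ` \<phi> ` N \<subseteq> N"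
      using U(2) NU by (auto simp: subset_iff)
    show "extends_smoothly_on N (\<lambda>x. \<psi> (act g x))"
    proof (rule extends_smoothly_on_compose[where f = "act g", OF _ _ V(2)])
      show "extends_smoothly_on N (act g)"
        using extends_smoothly_on_subset[OF act_smooth[OF g(1)]] NU US by blast
    qed (auto simp: N_def)
  qed
  have "smooth_on (\<phi> ` N) ((\<psi> \<circ> inv_into V \<pi>) \<circ> inv_into (\<pi> ` U) (\<phi> \<circ> inv_into U \<pi>))"
  proof (rule smooth_on_cong[OF op _ sm])
    fix y
    assume "y \<in> \<phi> ` N"
    then obtain z where z: "z \<in> U" "act g z \<in> V" "y = \<phi> z"
      by (auto simp: N_def)
    have inj: "inj_on (\<phi> \<circ> inv_into U \<pi>) (\<pi> ` U)"
      using injU U(2) by (auto simp: inj_on_def)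
    have "y = (\<phi> \<circ> inv_into U \<pi>) (\<pi> z)"
      using z injU by simp
    then have 1: "inv_into (\<pi> ` U) (\<phi> \<circ> inv_into U \<pi>) y = \<pi> z"
      using z(1) inv_into_f_f[OF inj, of "\<pi> z"] by blast
    have "\<pi> z = \<pi> (act g z)"
      using orbit_act[OF g(1), of z] z(1) US by auto
    then have 2: "inv_into V \<pi> (\<pi> z) = act g z"
      using inv_into_f_f[OF injV z(2)] by simp
    have 3: "inv_into U \<phi> y = z"
      using z U(2) by simp
    show "\<psi> (act g (inv_into U \<phi> y)) =
        ((\<psi> \<circ> inv_into V \<pi>) \<circ> inv_into (\<pi> ` U) (\<phi> \<circ> inv_into U \<pi>)) y"
      unfolding o_apply 3 by (simp only: 1[unfolded o_def] 2)
  qed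
  moreover have "w \<in> \<phi> ` N"
    using u v g US by (auto simp: N_def)
  ultimately show "\<exists>W. open W \<and> w \<in> W \<and>
      smooth_on W ((\<psi> \<circ> inv_into V \<pi>) \<circ> inv_into (\<pi> ` U) (\<phi> \<circ> inv_into U \<pi>))"
    using op by blast
qed

theorem smooth_manifold_orbit_manifold:
  assumes cover: "\<And>x. x \<in> S \<Longrightarrow> \<exists>U (\<phi> :: 'a \<Rightarrow> 'e::euclidean_space). x \<in> U \<and> embedded_chart S U \<phi>"
  shows "smooth_manifold (orbit_manifold G act (embedded_manifold S) :: ('a set, 'e) manifold)"
proof -
  define A where "A = {(\<pi> ` U, (\<phi> :: 'a \<Rightarrow> 'e) \<circ> inv_into U \<pi>) | U \<phi>. embedded_chart S U \<phi> \<and> inj_on \<pi> U}"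
  have M: "(orbit_manifold G act (embedded_manifold S) :: ('a set, 'e) manifold) = (quot, A)"
    by (simp add: orbit_manifold_def embedded_manifold_eq A_def)
  have A: "\<exists>V \<psi>. embedded_chart S V \<psi> \<and> inj_on \<pi> V \<and> c = (\<pi> ` V, (\<psi> :: 'a \<Rightarrow> 'e) \<circ> inv_into V \<pi>)"
    if "c \<in> A" for c
    using that unfolding A_def by blast
  have "\<forall>c\<in>A. is_chart quot c"
    using A orbit_chart_is_chart by metis
  moreover have "(\<Union>(U, \<phi>)\<in>A. U) = topspace quot"
  proof
    show "(\<Union>(U, \<phi>)\<in>A. U) \<subseteq> topspace quot"
      unfolding topspace_quot A_def embedded_chart_def using openin_imp_subset by fastforce
    show "topspace quot \<subseteq> (\<Union>(U, \<phi>)\<in>A. U)"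
    proof
      fix a
      assume "a \<in> topspace quot"
      then obtain x where x: "x \<in> S" "a = \<pi> x"
        unfolding topspace_quot by blast
      obtain N where N: "openin (top_of_set S) N" "x \<in> N" "inj_on \<pi> N"
        using projection_locally_injective[OF x(1)] by blast
      obtain U and \<phi> :: "'a \<Rightarrow> 'e" where U: "x \<in> U" "embedded_chart S U \<phi>"
        using cover[OF x(1)] by blast
      have "openin (top_of_set S) (U \<inter> N)"
        using U(2) N(1) unfolding embedded_chart_def by blast
      then have "embedded_chart S (U \<inter> N) \<phi>"
        by (rule embedded_chart_restrict[OF U(2)]) blast
      moreover have "inj_on \<pi> (U \<inter> N)"
        using N(3) inj_on_subset by blast
      ultimately have "(\<pi> ` (U \<inter> N), \<phi> \<circ> inv_into (U \<inter> N) \<pi>) \<in> A"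
        unfolding A_def by blast
      moreover have "a \<in> \<pi> ` (U \<inter> N)"
        using x N U by blast
      ultimately show "a \<in> (\<Union>(U, \<phi>)\<in>A. U)"
        by (intro UN_I[of "(\<pi> ` (U \<inter> N), \<phi> \<circ> inv_into (U \<inter> N) \<pi>)"]) simp_all
    qed
  qed
  moreover have "smooth_on (\<phi> ` (U \<inter> V)) (\<psi> \<circ> inv_into U \<phi>)"
    if U: "(U, \<phi>) \<in> A" and V: "(V, \<psi>) \<in> A" for U V \<phi> \<psi>
  proof -
    obtain U' \<phi>' where U': "embedded_chart S U' \<phi>'" "inj_on \<pi> U'"
      "U = \<pi> ` U'" "\<phi> = (\<phi>' :: 'a \<Rightarrow> 'e) \<circ> inv_into U' \<pi>"
      using A[OF U] by blast
    obtain V' \<psi>' where V': "embedded_chart S V' \<psi>'" "inj_on \<pi> V'"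
      "V = \<pi> ` V'" "\<psi> = (\<psi>' :: 'a \<Rightarrow> 'e) \<circ> inv_into V' \<pi>"
      using A[OF V] by blast
    show ?thesis
      unfolding U'(3,4) V'(3,4)
      by (rule orbit_chart_transition_smooth[OF U'(1,2) V'(1,2)])
  qed
  ultimately show ?thesis
    unfolding M smooth_manifold_def using Hausdorff_space_quot second_countable_quot by auto
qed

end


section \<open>The action on the sphere\<close>

definition root_of_unity :: "int \<Rightarrow> int \<Rightarrow> complex" where
  "root_of_unity p k = exp (2 * of_real pi * \<i> * of_int k / of_int p)"

lemma root_of_unity_add: "root_of_unity p (k + l) = root_of_unity p k * root_of_unity p l"
  by (simp add: root_of_unity_def add_divide_distrib distrib_left flip: exp_add)

lemma root_of_unity_0: "root_of_unity p 0 = 1"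
  by (simp add: root_of_unity_def)

lemma norm_root_of_unity: "norm (root_of_unity p k) = 1"
  by (simp add: root_of_unity_def)

lemma root_of_unity_eq_1_iff:
  assumes "p > 0"
  shows "root_of_unity p k = 1 \<longleftrightarrow> p dvd k"
proof -
  have "root_of_unity p k = 1 \<longleftrightarrow> (\<exists>n::int. 2 * pi * of_int k / of_int p = of_int (2 * n) * pi)"
    by (simp add: root_of_unity_def exp_eq_1)
  also have "\<dots> \<longleftrightarrow> (\<exists>n::int. real_of_int k = of_int (p * n))"
    using assms by (simp add: field_simps)
  also have "\<dots> \<longleftrightarrow> p dvd k"
    unfolding of_int_eq_iff by (auto simp: dvd_def)
  finally show ?thesis .
qed

lemma root_of_unity_cong:
  assumes "p > 0" "[k = l] (mod p)"
  shows "root_of_unity p k = root_of_unity p l"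
proof -
  have "root_of_unity p (k - l) = 1"
    using assms by (simp add: root_of_unity_eq_1_iff cong_iff_dvd_diff)
  then show ?thesis
    using root_of_unity_add[of p "k - l" l] by simp
qed

text \<open>The linear map of the whole ambient space whose restriction to the sphere is \<^const>\<open>lens_action\<close>;
  that it is linear is what makes the action smooth.\<close>

definition rotation :: "int \<Rightarrow> (int ^ 'n::finite) \<Rightarrow> int \<Rightarrow> (complex ^ 'n) \<times> complex \<Rightarrow> (complex ^ 'n) \<times> complex" where
  "rotation p q k z = (\<chi> i. root_of_unity p (k * q $ i) * fst z $ i, root_of_unity p k * snd z)"

lemma lens_action_eq: "lens_action p q k = restrict (rotation p q k) (sphere 0 1)"
  unfolding lens_action_def rotation_def root_of_unity_def ..

lemma rotation_cong:
  assumes "p > 0" "\<And>i. [q $ i = r $ i] (mod p)" "[k = l] (mod p)"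
  shows "rotation p q k = rotation p r l"
proof -
  have "root_of_unity p (k * q $ i) = root_of_unity p (l * r $ i)" for i
    using assms by (intro root_of_unity_cong cong_mult)
  then show ?thesis
    using root_of_unity_cong[OF assms(1,3)] by (simp add: rotation_def fun_eq_iff)
qed

lemma rotation_0: "rotation p q 0 z = z"
  by (simp add: rotation_def root_of_unity_0)

lemma rotation_add: "rotation p q (k + l) z = rotation p q k (rotation p q l z)"
  by (simp add: rotation_def root_of_unity_add distrib_right mult.assoc)

lemma norm_rotation: "norm (rotation p q k z) = norm z"
  by (simp add: rotation_def norm_Pair norm_prod_def norm_vec_def norm_mult norm_root_of_unity)

lemma bounded_linear_rotation: "bounded_linear (rotation p q k)"
  unfolding linear_conv_bounded_linear[symmetric]
  by (rule linearI) (simp_all add: rotation_def vec_eq_iff algebra_simps scaleR_conv_of_real)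

text \<open>A fixed point has a nonzero coordinate. If this is the last one, the \<open>k\<close>-th power of the
  primitive root of unity is 1; otherwise the \<open>k q\<^sub>i\<close>-th is, and \<open>q\<^sub>i\<close> can be cancelled modulo \<open>p\<close>.\<close>

lemma rotation_free:
  assumes "p > 0" "\<And>i. coprime p (q $ i)" "z \<noteq> 0" "rotation p q k z = z"
  shows "p dvd k"
proof (cases "snd z = 0")
  case False
  then have "root_of_unity p k = 1"
    using arg_cong[OF assms(4), of snd] by (simp add: rotation_def)
  then show ?thesis
    using assms(1) root_of_unity_eq_1_iff by blast
next
  case True
  then have "fst z \<noteq> 0"
    using assms(3) by (simp add: prod_eq_iff)
  then obtain i where i: "fst z $ i \<noteq> 0"
    by (auto simp: vec_eq_iff)
  have "root_of_unity p (k * q $ i) * fst z $ i = fst z $ i"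
    using arg_cong[OF assms(4), of "\<lambda>z. fst z $ i"] by (simp add: rotation_def)
  then have "p dvd k * q $ i"
    using i assms(1) root_of_unity_eq_1_iff by simp
  then show ?thesis
    using assms(2) by (simp add: coprime_dvd_mult_left_iff)
qed

lemma group_action_lens_action:
  assumes "p > 0"
  shows "group_action (integer_mod_group (nat p)) (sphere 0 1) (lens_action p q)"
proof -
  let ?S = "sphere 0 1 :: ((complex ^ 'n) \<times> complex) set"
  have closed: "rotation p q k z \<in> ?S" if "z \<in> ?S" for k z
    using that by (simp add: norm_rotation)
  have inverse: "rotation p q (- k) (rotation p q k z) = z"
    "rotation p q k (rotation p q (- k) z) = z" for k z
    using rotation_add[of p q "- k" k z] rotation_add[of p q k "- k" z] by (simp_all add: rotation_0)
  have "bij_betw (rotation p q k) ?S ?S" for k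
    using closed inverse by (intro bij_betw_byWitness[where f' = "rotation p q (- k)"]) auto
  then have Bij: "lens_action p q k \<in> Bij ?S" for k
    by (simp add: lens_action_eq Bij_def)
  have "lens_action p q ((k + l) mod p) = compose ?S (lens_action p q k) (lens_action p q l)" for k l
  proof -
    have "rotation p q ((k + l) mod p) = rotation p q (k + l)"
      by (rule rotation_cong[OF assms]) (simp_all add: cong_def)
    then show ?thesis
      using closed by (auto simp: lens_action_eq compose_def rotation_add fun_eq_iff)
  qed
  then have "lens_action p q \<in> hom (integer_mod_group (nat p)) (BijGroup ?S)"
    using Bij assms by (auto simp: hom_def BijGroup_def)
  then show ?thesis
    by (intro group_action.intro group_hom.intro group_hom_axioms.intro group_BijGroup
        group_integer_mod_group)
qed

lemma smooth_manifold_lens_space: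
  fixes q :: "int ^ 'n::finite"
  assumes "p > 0" "\<And>i. coprime p (q $ i)"
  shows "smooth_manifold (lens_space p q)"
proof -
  let ?S = "sphere 0 1 :: ((complex ^ 'n) \<times> complex) set"
  have "finite (carrier (integer_mod_group (nat p)))"
    using assms(1) by (simp add: carrier_integer_mod_group)
  moreover have "extends_smoothly_on ?S (lens_action p q k)" for k
    by (rule bounded_linear_extends_smoothly_on[OF bounded_linear_rotation])
      (simp add: lens_action_eq)
  moreover have "k = \<one>\<^bsub>integer_mod_group (nat p)\<^esub>"
    if k: "k \<in> carrier (integer_mod_group (nat p))" and z: "z \<in> ?S" "lens_action p q k z = z" for k z
  proof -
    have "z \<noteq> 0" "rotation p q k z = z"
      using z by (auto simp: lens_action_eq)
    then have "p dvd k"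
      using rotation_free[OF assms] by blast
    \<comment> \<open>Group elements are represented by \<open>0, \<dots>, p - 1\<close>, of which only 0 is divisible by \<open>p\<close>.\<close>
    moreover have "0 \<le> k" "k < p"
      using k assms(1) by (simp_all add: carrier_integer_mod_group)
    ultimately show ?thesis
      using zdvd_imp_le[of p k] by (cases "k = 0") auto
  qed
  ultimately interpret free_smooth_action "integer_mod_group (nat p)" ?S "lens_action p q"
    using group_action_lens_action[OF assms(1)]
    by (intro free_smooth_action.intro free_smooth_action_axioms.intro) auto
  have "DIM((complex ^ 'n) \<times> complex) = Suc DIM((complex ^ 'n) \<times> real)"
    by simp
  then show ?thesis
    unfolding lens_space_def
    by (intro smooth_manifold_orbit_manifold unit_sphere_embedded_chart)
qed

section \<open>Weights modulo p and the diffeomorphism\<close>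

lemma det_map_matrix_of_int:
  fixes A :: "int ^ 'n ^ 'n"
  shows "det (\<chi> i j. real_of_int (A $ i $ j)) = of_int (det A)"
  by (simp add: det_def)

text \<open>Cramer's rule over the reals expresses the inverse by determinants of integer matrices, divided
  by \<open>det A = 1\<close>. So the inverse has integer entries, and the equations for it hold over the
  integers because they hold over the reals.\<close>

lemma invertible_int_matrix_det_1:
  fixes A :: "int ^ 'n ^ 'n"
  assumes "det A = 1"
  shows "invertible A"
proof -
  define real_matrix :: "int ^ 'n ^ 'n \<Rightarrow> real ^ 'n ^ 'n"
    where "real_matrix X = (\<chi> i j. of_int (X $ i $ j))" for X
  \<comment> \<open>By Cramer, column \<open>l\<close> of the inverse solves \<open>A x = axis l 1\<close>.\<close>
  define C :: "int ^ 'n ^ 'n"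
    where "C = (\<chi> k l. det (\<chi> i j. if j = k then axis l 1 $ i else A $ i $ j))"
  have det: "det (real_matrix X) = of_int (det X)" for X
    by (simp add: real_matrix_def det_map_matrix_of_int)
  have det_A: "det (real_matrix A) = 1"
    by (simp add: det assms)
  have mult: "real_matrix (X ** Y) = real_matrix X ** real_matrix Y" for X Y
    by (simp add: real_matrix_def matrix_matrix_mult_def vec_eq_iff)
  have one: "real_matrix (mat 1) = mat 1"
    by (simp add: real_matrix_def mat_def vec_eq_iff)
  have inj: "X = Y" if "real_matrix X = real_matrix Y" for X Y
    using that by (simp add: real_matrix_def vec_eq_iff)
  have "column l (real_matrix C) =
      (\<chi> k. det (\<chi> i j. if j = k then axis l 1 $ i else real_matrix A $ i $ j) / det (real_matrix A))" for l
  proof -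
    have "real_matrix (\<chi> i j. if j = k then axis l 1 $ i else A $ i $ j) =
        (\<chi> i j. if j = k then axis l 1 $ i else real_matrix A $ i $ j)" for k
      by (simp add: real_matrix_def vec_eq_iff axis_def)
    then show ?thesis
      using det_A by (simp add: column_def C_def vec_eq_iff real_matrix_def[of "vec_lambda _"] flip: det)
  qed
  then have "real_matrix A *v column l (real_matrix C) = axis l 1" for l
    using cramer[of "real_matrix A"] det_A by simp
  then have "real_matrix A ** real_matrix C = mat 1"
    by (simp add: vec_eq_iff matrix_vector_mult_def matrix_matrix_mult_def column_def axis_def mat_def)
  moreover from this have "real_matrix C ** real_matrix A = mat 1"
    by (rule matrix_left_right_inverse1)
  ultimately have "A ** C = mat 1" "C ** A = mat 1"
    by (auto intro!: inj simp: mult one)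
  then show ?thesis
    unfolding invertible_def by blast
qed

lemma matrix_inv_left_inverse: "invertible A \<Longrightarrow> matrix_inv A ** A = mat 1"
  unfolding invertible_def matrix_inv_def by (metis (mono_tags, lifting) someI_ex)

lemma lens_action_cong:
  assumes "p > 0" "\<And>i. [q $ i = r $ i] (mod p)"
  shows "lens_action p q = lens_action p r"
  using rotation_cong[OF assms cong_refl] by (simp add: lens_action_eq fun_eq_iff)

text \<open>Modulo \<open>p\<close> the construction undoes itself: \<open>q' = - B\<inverse> a' \<equiv> - B\<inverse> a = - B\<inverse> B (- q) = q\<close>.
  Passing from \<open>a'\<close> to \<open>a\<close> uses that \<open>B\<inverse>\<close> has integer entries.\<close>

lemma modified_weights_cong:
  fixes q r a a' q' :: "int ^ 'n::finite" and B :: "int ^ 'n ^ 'n"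
  assumes "det B = 1" "a = B *v (- q)" "\<And>i. [a' $ i = a $ i] (mod p)"
    "q' = - (matrix_inv B *v a')" "\<And>i. [r $ i = q' $ i] (mod p)"
  shows "[q $ i = r $ i] (mod p)"
proof -
  have "matrix_inv B *v a = - q"
    using matrix_inv_left_inverse[OF invertible_int_matrix_det_1[OF assms(1)]]
    by (simp add: assms(2) matrix_vector_mul_assoc)
  moreover have "[(matrix_inv B *v a') $ i = (matrix_inv B *v a) $ i] (mod p)"
    unfolding matrix_vector_mult_def by (simp add: cong_sum cong_scalar_left assms(3))
  ultimately have "[(matrix_inv B *v a') $ i = - q $ i] (mod p)"
    by simp
  then have "[q' $ i = q $ i] (mod p)"
    using cong_minus_minus_iff[of "(matrix_inv B *v a') $ i" "- q $ i" p] by (simp add: assms(4))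
  then show ?thesis
    using assms(5)[of i] cong_sym cong_trans by blast
qed

text \<open>In charts the identity map of a manifold is a change of charts.\<close>

lemma diffeomorphic_refl:
  assumes "smooth_manifold M"
  shows "diffeomorphic M M"
proof -
  obtain X A where M: "M = (X, A)"
    by (cases M)
  have "{x \<in> U. x \<in> V} = U \<inter> V" for U V :: "'a set"
    by blast
  then have "smooth_map M M (\<lambda>x. x)"
    using assms unfolding M smooth_map_def smooth_manifold_def by (auto simp: comp_def)
  then show ?thesis
    using assms unfolding diffeomorphic_def by blast
qed

theorem lemma2p7:
  fixes p :: int
    and q r a a' q' :: "int ^ 'n::finite"
    and B :: "int ^ 'n ^ 'n"
  assumes "p > 0"
    and "\<And>i. coprime p (q $ i)"
    and "det B = 1"
    and "a = B *v (- q)"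
    and "\<And>i. [a' $ i = a $ i] (mod p)"
    and "q' = - (matrix_inv B *v a')"
    and "\<And>i. [r $ i = q' $ i] (mod p)"
  shows "diffeomorphic (lens_space p q) (lens_space p r)"
proof -
  have cong: "[q $ i = r $ i] (mod p)" for i
    by (rule modified_weights_cong[OF assms(3-7)])
  have "lens_space p q = lens_space p r"
    by (simp add: lens_space_def lens_action_cong[OF assms(1) cong])
  then show ?thesis
    using diffeomorphic_refl[OF smooth_manifold_lens_space[OF assms(1,2)]] by simp
qed

end
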